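(* Let $\{J_1,J_2,J_3\}$ be an almost para-hypercomplex structure on a smooth four-manifold $M$, and let $g$ and $h$ be two metrics on $M$ compatible with $\{J_1,J_2,J_3\}$. Then there exists a unique non-vanishing smooth function $f:M\to\mathbb{R}$ such that $g=f\,h$.
   Context: An almost para-hypercomplex structure on a smooth $4$-manifold $M$ is a triple $\{J_1,J_2,J_3\}$ of smooth endomorphisms of $TM$ such that $J_1^2=-J_2^2=-J_3^2=-\mathrm{Id}$ and $J_1J_2=-J_2J_1=J_3$. A metric (i.e. a pseudo-Riemannian metric: a smooth non-degenerate symmetric $(0,2)$-tensor, not assumed positive definite) $g$ on $M$ is compatible with $\{J_1,J_2,J_3\}$ if $g(J_1X,J_1Y)=-g(J_2X,J_2Y)=-g(J_3X,J_3Y)=g(X,Y)$ for all tangent vectors $X,Y$ at any point of $M$. "Non-vanishing" means nowhere zero. *)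

theory Defs
  imports "HOL-Analysis.Analysis"
begin

section \<open>Smooth maps between open subsets of normed spaces\<close>

text \<open>\<open>Ck_on S k f\<close> is meant for open \<open>S\<close>: all iterated directional derivatives of \<open>f\<close> up to
  order \<open>k\<close> exist (as Frechet derivatives) and are continuous on \<open>S\<close>.\<close>

primrec Ck_on ::
  "'a::real_normed_vector set \<Rightarrow> nat \<Rightarrow> ('a \<Rightarrow> 'b::real_normed_vector) \<Rightarrow> bool"
where
  "Ck_on S 0 f \<longleftrightarrow> continuous_on S f"
| "Ck_on S (Suc k) f \<longleftrightarrow>
     (\<forall>x\<in>S. f differentiable (at x)) \<and>
     (\<forall>v. Ck_on S k (\<lambda>x. frechet_derivative f (at x) v))"

definition smooth_on ::
  "'a::real_normed_vector set \<Rightarrow> ('a \<Rightarrow> 'b::real_normed_vector) \<Rightarrow> bool"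
where
  "smooth_on S f \<longleftrightarrow> (\<forall>k. Ck_on S k f)"


section \<open>Smooth manifolds\<close>

text \<open>A chart is a pair of its domain and its coordinate map. The values of the coordinate map
  outside the domain are irrelevant for \<open>is_chart\<close>.\<close>

type_synonym ('m, 'e) chart = "'m set \<times> ('m \<Rightarrow> 'e)"

abbreviation chart_dom :: "('m, 'e) chart \<Rightarrow> 'm set" where
  "chart_dom c \<equiv> fst c"

abbreviation chart_map :: "('m, 'e) chart \<Rightarrow> 'm \<Rightarrow> 'e" where
  "chart_map c \<equiv> snd c"

abbreviation chart_img :: "('m, 'e) chart \<Rightarrow> 'e set" where
  "chart_img c \<equiv> chart_map c ` chart_dom c"

definition chart_inv :: "('m, 'e) chart \<Rightarrow> 'e \<Rightarrow> 'm" where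
  "chart_inv c = inv_into (chart_dom c) (chart_map c)"

definition is_chart :: "('m::topological_space, 'e::euclidean_space) chart \<Rightarrow> bool" where
  "is_chart c \<longleftrightarrow>
     open (chart_dom c) \<and> open (chart_img c) \<and>
     homeomorphism (chart_dom c) (chart_img c) (chart_map c) (chart_inv c)"

definition transition :: "('m, 'e) chart \<Rightarrow> ('m, 'e) chart \<Rightarrow> 'e \<Rightarrow> 'e" where
  "transition c d = chart_map d \<circ> chart_inv c"

text \<open>The manifold is the whole type \<open>'m\<close>, whose classes make it Hausdorff and second countable;
  its dimension is \<open>DIM('e)\<close>. The atlas need not be maximal: adding further compatible
  charts leaves the notions below the same, up to the evident identification of tangent vectors.\<close>

definition smooth_atlas ::
  "('m::{t2_space, second_countable_topology}, 'e::euclidean_space) chart set \<Rightarrow> bool"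
where
  "smooth_atlas A \<longleftrightarrow>
     (\<forall>c\<in>A. is_chart c) \<and>
     (\<Union>c\<in>A. chart_dom c) = UNIV \<and>
     (\<forall>c\<in>A. \<forall>d\<in>A. smooth_on (chart_map c ` (chart_dom c \<inter> chart_dom d)) (transition c d))"

definition charts_at :: "('m, 'e) chart set \<Rightarrow> 'm \<Rightarrow> ('m, 'e) chart set" where
  "charts_at A p = {c \<in> A. p \<in> chart_dom c}"

definition smooth_fun ::
  "('m, 'e::euclidean_space) chart set \<Rightarrow> ('m \<Rightarrow> real) \<Rightarrow> bool"
where
  "smooth_fun A f \<longleftrightarrow> (\<forall>c\<in>A. smooth_on (chart_img c) (f \<circ> chart_inv c))"


section \<open>Tangent spaces\<close>

text \<open>A tangent vector at \<open>p\<close> assigns to every chart around \<open>p\<close> a coordinate vector, and these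
  are related by the derivatives of the transition maps. The value is fixed to \<open>0\<close> at all
  other pairs, so that equality of tangent vectors is equality of functions. The vector space
  operations are pointwise.\<close>

type_synonym ('m, 'e) tangent = "('m, 'e) chart \<Rightarrow> 'e"

definition tangent_space ::
  "('m, 'e::euclidean_space) chart set \<Rightarrow> 'm \<Rightarrow> ('m, 'e) tangent set"
where
  "tangent_space A p = {X.
     (\<forall>c\<in>charts_at A p. \<forall>d\<in>charts_at A p.
        X d = frechet_derivative (transition c d) (at (chart_map c p)) (X c)) \<and>
     (\<forall>c. c \<notin> charts_at A p \<longrightarrow> X c = 0)}"

definition lincomb ::
  "real \<Rightarrow> ('m, 'e::real_vector) tangent \<Rightarrow> real \<Rightarrow> ('m, 'e) tangent \<Rightarrow> ('m, 'e) tangent"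
where
  "lincomb a X b Y = (\<lambda>c. a *\<^sub>R X c + b *\<^sub>R Y c)"

text \<open>The tangent vector at \<open>p\<close> whose coordinates in the chart \<open>c\<close> (around \<open>p\<close>) are \<open>v\<close>. For
  \<open>v \<in> Basis\<close> these are the coordinate vector fields of \<open>c\<close>.\<close>

definition coord_vector ::
  "('m, 'e::euclidean_space) chart set \<Rightarrow> ('m, 'e) chart \<Rightarrow> 'e \<Rightarrow> 'm \<Rightarrow> ('m, 'e) tangent"
where
  "coord_vector A c v p =
     (\<lambda>d. if d \<in> charts_at A p
          then frechet_derivative (transition c d) (at (chart_map c p)) v else 0)"


section \<open>Endomorphisms of the tangent bundle and metrics\<close>

text \<open>Values at arguments outside the tangent spaces are never constrained. Smoothness means
  that the components with respect to the coordinate frame of every chart are smooth.\<close>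

type_synonym ('m, 'e) endo_field = "'m \<Rightarrow> ('m, 'e) tangent \<Rightarrow> ('m, 'e) tangent"

type_synonym ('m, 'e) bilinear_field = "'m \<Rightarrow> ('m, 'e) tangent \<Rightarrow> ('m, 'e) tangent \<Rightarrow> real"

definition smooth_endomorphism ::
  "('m, 'e::euclidean_space) chart set \<Rightarrow> ('m, 'e) endo_field \<Rightarrow> bool"
where
  "smooth_endomorphism A J \<longleftrightarrow>
     (\<forall>p. \<forall>X\<in>tangent_space A p. J p X \<in> tangent_space A p) \<and>
     (\<forall>p. \<forall>X\<in>tangent_space A p. \<forall>Y\<in>tangent_space A p. \<forall>a b.
        J p (lincomb a X b Y) = lincomb a (J p X) b (J p Y)) \<and>
     (\<forall>c\<in>A. \<forall>i\<in>Basis. \<forall>j\<in>Basis. smooth_on (chart_img c)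
        (\<lambda>x. J (chart_inv c x) (coord_vector A c j (chart_inv c x)) c \<bullet> i))"

definition smooth_symmetric_2tensor ::
  "('m, 'e::euclidean_space) chart set \<Rightarrow> ('m, 'e) bilinear_field \<Rightarrow> bool"
where
  "smooth_symmetric_2tensor A g \<longleftrightarrow>
     (\<forall>p. \<forall>X\<in>tangent_space A p. \<forall>Y\<in>tangent_space A p. \<forall>Z\<in>tangent_space A p. \<forall>a b.
        g p (lincomb a X b Y) Z = a * g p X Z + b * g p Y Z) \<and>
     (\<forall>p. \<forall>X\<in>tangent_space A p. \<forall>Y\<in>tangent_space A p. g p X Y = g p Y X) \<and>
     (\<forall>c\<in>A. \<forall>i\<in>Basis. \<forall>j\<in>Basis. smooth_on (chart_img c)
        (\<lambda>x. g (chart_inv c x) (coord_vector A c i (chart_inv c x))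
                                (coord_vector A c j (chart_inv c x))))"

definition pseudo_riemannian_metric ::
  "('m, 'e::euclidean_space) chart set \<Rightarrow> ('m, 'e) bilinear_field \<Rightarrow> bool"
where
  "pseudo_riemannian_metric A g \<longleftrightarrow>
     smooth_symmetric_2tensor A g \<and>
     (\<forall>p. \<forall>X\<in>tangent_space A p.
        (\<forall>Y\<in>tangent_space A p. g p X Y = 0) \<longrightarrow> X = (\<lambda>c. 0))"


section \<open>Almost para-hypercomplex structures\<close>

definition almost_para_hypercomplex ::
  "('m, 'e::euclidean_space) chart set \<Rightarrow> ('m, 'e) endo_field \<Rightarrow> ('m, 'e) endo_field
     \<Rightarrow> ('m, 'e) endo_field \<Rightarrow> bool"
where
  "almost_para_hypercomplex A J1 J2 J3 \<longleftrightarrow>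
     smooth_endomorphism A J1 \<and> smooth_endomorphism A J2 \<and> smooth_endomorphism A J3 \<and>
     (\<forall>p. \<forall>X\<in>tangent_space A p.
        J1 p (J1 p X) = - X \<and> J2 p (J2 p X) = X \<and> J3 p (J3 p X) = X \<and>
        J1 p (J2 p X) = J3 p X \<and> J2 p (J1 p X) = - J3 p X)"

definition compatible ::
  "('m, 'e::euclidean_space) chart set \<Rightarrow> ('m, 'e) endo_field \<Rightarrow> ('m, 'e) endo_field
     \<Rightarrow> ('m, 'e) endo_field \<Rightarrow> ('m, 'e) bilinear_field \<Rightarrow> bool"
where
  "compatible A J1 J2 J3 g \<longleftrightarrow>
     (\<forall>p. \<forall>X\<in>tangent_space A p. \<forall>Y\<in>tangent_space A p.
        g p (J1 p X) (J1 p Y) = g p X Y \<and>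
        - g p (J2 p X) (J2 p Y) = g p X Y \<and>
        - g p (J3 p X) (J3 p Y) = g p X Y)"

end

theory Submission
  imports Defs
begin

text \<open>If \<open>h\<close> is compatible, then \<open>x\<close>, \<open>J1 x\<close>, \<open>J2 x\<close>, \<open>J3 x\<close> are pairwise \<open>h\<close>-orthogonal with squares
  \<open>h x x\<close>, \<open>h x x\<close>, \<open>- h x x\<close>, \<open>- h x x\<close>. Choosing \<open>x\<close> with \<open>h x x \<noteq> 0\<close> they form a basis of the
  tangent space, so both \<open>g\<close> and \<open>h\<close> are multiples of one bilinear form, with factors \<open>g x x\<close>
  and \<open>h x x\<close>. In a chart the resulting factor is
  \<open>(\<Sum>i j. g i j * h i j) / (\<Sum>i j. (h i j)\<^sup>2)\<close>, which is smooth because the denominator vanishes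
  nowhere.\<close>

section \<open>Calculus of real-valued smooth functions\<close>

text \<open>On an open set a derivative depends only on the values in \<open>S\<close>. The
  induction generalizes over both functions because it passes to their directional
  derivatives.\<close>

lemma Ck_on_cong:
  assumes "open S" and "\<And>x. x \<in> S \<Longrightarrow> f x = g x" and "Ck_on S k f"
  shows "Ck_on S k g"
  using assms(2,3)
proof (induction k arbitrary: f g)
  case 0
  then show ?case by (auto cong: continuous_on_cong)
next
  case (Suc k)
  have der: "(g has_derivative frechet_derivative f (at x)) (at x)" if "x \<in> S" for x
  proof -
    have "(f has_derivative frechet_derivative f (at x)) (at x)"
      using Suc.prems(2) that frechet_derivative_works by auto
    then show ?thesis
      by (rule has_derivative_transform_within_open[OF _ assms(1) that]) (use Suc.prems in auto)
  qed
  then have "frechet_derivative f (at x) = frechet_derivative g (at x)" if "x \<in> S" for x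
    using that by (metis frechet_derivative_at)
  then have "Ck_on S k (\<lambda>x. frechet_derivative g (at x) v)" for v
    using Suc.IH[of "\<lambda>x. frechet_derivative f (at x) v" "\<lambda>x. frechet_derivative g (at x) v"]
      Suc.prems(2) by simp
  then show ?case
    using der by (auto simp: differentiable_def)
qed

text \<open>Uniqueness of derivatives lets any explicit formula \<open>D\<close>, correct on
  \<open>S\<close>, replace the chosen \<open>frechet_derivative\<close>.\<close>

lemma Ck_on_SucI:
  assumes "open S"
    and "\<And>x. x \<in> S \<Longrightarrow> (f has_derivative D x) (at x)"
    and "\<And>v. Ck_on S k (\<lambda>x. D x v)"
  shows "Ck_on S (Suc k) f"
proof -
  have "D x = frechet_derivative f (at x)" if "x \<in> S" for x
    using assms(2)[OF that] by (rule frechet_derivative_at)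
  then have "Ck_on S k (\<lambda>x. frechet_derivative f (at x) v)" for v
    using Ck_on_cong[OF assms(1) _ assms(3)] by simp
  then show ?thesis
    using assms(2) by (auto simp: differentiable_def)
qed

lemma Ck_on_SucD:
  assumes "Ck_on S (Suc k) f"
  shows "x \<in> S \<Longrightarrow> (f has_derivative frechet_derivative f (at x)) (at x)"
    and "Ck_on S k (\<lambda>x. frechet_derivative f (at x) v)"
  using assms by (simp_all flip: frechet_derivative_works)

lemma Ck_on_Suc_imp: "Ck_on S (Suc k) f \<Longrightarrow> Ck_on S k f"
proof (induction k arbitrary: f)
  case 0
  then show ?case
    by (simp add: differentiable_imp_continuous_on differentiable_on_def differentiable_at_withinI)
next
  case (Suc k)
  show ?case
    unfolding Ck_on.simps(2)
  proof (intro conjI allI)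
    show "\<forall>x\<in>S. f differentiable at x"
      using Suc.prems by simp
    show "Ck_on S k (\<lambda>x. frechet_derivative f (at x) v)" for v
      by (intro Suc.IH Ck_on_SucD(2) Suc.prems)
  qed
qed

lemma Ck_on_const:
  assumes "open S"
  shows "Ck_on S k (\<lambda>_. a)"
proof (induction k arbitrary: a)
  case 0
  then show ?case by simp
next
  case (Suc k)
  show ?case
    by (rule Ck_on_SucI[OF assms, where D="\<lambda>_ _. 0"]) (simp_all add: Suc)
qed

lemma Ck_on_add:
  assumes "open S" and "Ck_on S k f" and "Ck_on S k g"
  shows "Ck_on S k (\<lambda>x. f x + g x)"
  using assms(2,3)
proof (induction k arbitrary: f g)
  case 0
  then show ?case by (auto intro: continuous_intros)
next
  case (Suc k)
  show ?case
  proof (rule Ck_on_SucI[OF assms(1)])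
    show "((\<lambda>x. f x + g x) has_derivative
      (\<lambda>v. frechet_derivative f (at x) v + frechet_derivative g (at x) v)) (at x)"
      if "x \<in> S" for x
      by (intro has_derivative_add Ck_on_SucD(1)[where S=S and k=k] that Suc.prems)
    show "Ck_on S k (\<lambda>x. frechet_derivative f (at x) v + frechet_derivative g (at x) v)" for v
      by (intro Suc.IH Ck_on_SucD(2) Suc.prems)
  qed
qed

lemma Ck_on_mult:
  fixes f g :: "'a::real_normed_vector \<Rightarrow> real"
  assumes "open S" and "Ck_on S k f" and "Ck_on S k g"
  shows "Ck_on S k (\<lambda>x. f x * g x)"
  using assms(2,3)
proof (induction k arbitrary: f g)
  case 0
  then show ?case by (auto intro: continuous_intros)
next
  case (Suc k)
  show ?case
  proof (rule Ck_on_SucI[OF assms(1)])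
    show "((\<lambda>x. f x * g x) has_derivative
      (\<lambda>v. f x * frechet_derivative g (at x) v + frechet_derivative f (at x) v * g x)) (at x)"
      if "x \<in> S" for x
      by (intro has_derivative_mult Ck_on_SucD(1)[where S=S and k=k] that Suc.prems)
    \<comment> \<open>The product rule also contains \<open>f\<close> and \<open>g\<close>
      undifferentiated; their order is lowered with \<open>Ck_on_Suc_imp\<close>.\<close>
    show "Ck_on S k
      (\<lambda>x. f x * frechet_derivative g (at x) v + frechet_derivative f (at x) v * g x)" for v
      by (intro Ck_on_add assms(1) Suc.IH Ck_on_SucD(2) Suc.prems Suc.prems[THEN Ck_on_Suc_imp])
  qed
qed

text \<open>The derivative of \<open>1/f\<close> is built from \<open>1/f\<close> and the derivative
  of \<open>f\<close>, so \<open>f\<close> stays fixed and the induction feeds the inverse at order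
  \<open>k\<close> back into the product rule.\<close>

lemma Ck_on_inverse:
  fixes f :: "'a::real_normed_vector \<Rightarrow> real"
  assumes "open S" and "\<And>x. x \<in> S \<Longrightarrow> f x \<noteq> 0" and "Ck_on S k f"
  shows "Ck_on S k (\<lambda>x. inverse (f x))"
  using assms(3)
proof (induction k)
  case 0
  then show ?case using assms(2) by (auto intro: continuous_intros)
next
  case (Suc k)
  have inv: "Ck_on S k (\<lambda>x. inverse (f x))"
    using Suc.IH Ck_on_Suc_imp[OF Suc.prems] by simp
  show ?case
  proof (rule Ck_on_SucI[OF assms(1)])
    show "((\<lambda>x. inverse (f x)) has_derivative
      (\<lambda>v. - 1 * (inverse (f x) * frechet_derivative f (at x) v * inverse (f x)))) (at x)"
      if "x \<in> S" for x
      using Deriv.has_derivative_inverse[OF assms(2)[OF that] Ck_on_SucD(1)[OF Suc.prems that]] by simp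
    show "Ck_on S k (\<lambda>x. - 1 * (inverse (f x) * frechet_derivative f (at x) v * inverse (f x)))"
      for v
      by (intro Ck_on_mult Ck_on_const assms(1) inv Ck_on_SucD(2)[OF Suc.prems])
  qed
qed

lemma Ck_on_sum:
  assumes "open S" and "\<And>i. i \<in> I \<Longrightarrow> Ck_on S k (f i)"
  shows "Ck_on S k (\<lambda>x. \<Sum>i\<in>I. f i x)"
  using assms(2)
proof (induction I rule: infinite_finite_induct)
  case (insert i I)
  then show ?case
    using Ck_on_add[OF assms(1), of k "f i" "\<lambda>x. \<Sum>i\<in>I. f i x"] by simp
qed (simp_all add: Ck_on_const[OF assms(1)])

section \<open>The algebra of a tangent space\<close>

lemma compatible_form_in_frame:
  fixes b :: "'a::real_vector \<Rightarrow> 'a \<Rightarrow> real"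
  assumes b: "bilinear b" and sym: "\<And>v w. b v w = b w v"
    and c1: "\<And>v w. b (J1 v) (J1 w) = b v w"
    and c2: "\<And>v w. b (J2 v) (J2 w) = - b v w"
    and c3: "\<And>v w. b (J3 v) (J3 w) = - b v w"
    and r: "\<And>v. J1 (J1 v) = - v" "\<And>v. J2 (J2 v) = v" "\<And>v. J3 (J3 v) = v"
      "\<And>v. J1 (J2 v) = J3 v" "\<And>v. J2 (J1 v) = - J3 v"
  shows "b (s1 *\<^sub>R x + s2 *\<^sub>R J1 x + s3 *\<^sub>R J2 x + s4 *\<^sub>R J3 x)
           (t1 *\<^sub>R x + t2 *\<^sub>R J1 x + t3 *\<^sub>R J2 x + t4 *\<^sub>R J3 x)
         = b x x * (s1 * t1 + s2 * t2 - s3 * t3 - s4 * t4)"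
proof -
  note bl = bilinear_ladd[OF b] bilinear_radd[OF b] bilinear_lmul[OF b] bilinear_rmul[OF b]
  note neg = bilinear_lneg[OF b] bilinear_rneg[OF b]
  \<comment> \<open>Applying \<open>J1\<close> to both arguments gives
    \<open>b x (J1 x) = - b (J1 x) x\<close>, which symmetry forces to be 0. For \<open>J2\<close>
    and \<open>J3\<close> the sign comes from compatibility instead of from the square.\<close>
  have x1: "b x (J1 x) = 0"
    using c1[of x "J1 x"] sym[of "J1 x" x] by (simp add: r neg)
  have x2: "b x (J2 x) = 0"
    using c2[of x "J2 x"] sym[of "J2 x" x] by (simp add: r)
  have x3: "b x (J3 x) = 0"
    using c3[of x "J3 x"] sym[of "J3 x" x] by (simp add: r)
  have j13: "J1 (J3 x) = - J2 x"
    using r(1)[of "J2 x"] by (simp add: r(4))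
  have j23: "J2 (J3 x) = - J1 x"
    using r(5)[of "J2 x"] r(4)[of "J2 x"] by (simp add: r)
  \<comment> \<open>Applying \<open>J1\<close> or \<open>J2\<close> to both arguments turns the
    remaining mixed products into ones known to vanish.\<close>
  have y12: "b (J1 x) (J2 x) = 0"
    using c1[of "J1 x" "J2 x"] x3 by (simp add: r neg)
  have y13: "b (J1 x) (J3 x) = 0"
    using c1[of "J1 x" "J3 x"] x2 by (simp add: r j13 neg)
  have y23: "b (J2 x) (J3 x) = 0"
    using c2[of "J2 x" "J3 x"] x1 by (simp add: r j23 neg)
  note z = x1 x2 x3 y12 y13 y23
  note z' = z[THEN trans[OF sym]]
  show ?thesis
    \<comment> \<open>Of the sixteen terms of the expansion, twelve vanish and the four squares are
      \<open>b x x\<close> up to sign.\<close>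
    by (simp only: bl, simp only: z z', simp only: c1 c2 c3, simp add: algebra_simps)
qed

lemma compatible_forms_proportional:
  fixes g h :: "real^4 \<Rightarrow> real^4 \<Rightarrow> real"
  assumes g: "bilinear g" "\<And>v w. g v w = g w v"
      "\<And>v w. g (J1 v) (J1 w) = g v w"
      "\<And>v w. g (J2 v) (J2 w) = - g v w"
      "\<And>v w. g (J3 v) (J3 w) = - g v w"
    and h: "bilinear h" "\<And>v w. h v w = h w v"
      "\<And>v w. h (J1 v) (J1 w) = h v w"
      "\<And>v w. h (J2 v) (J2 w) = - h v w"
      "\<And>v w. h (J3 v) (J3 w) = - h v w"
    and r: "\<And>v. J1 (J1 v) = - v" "\<And>v. J2 (J2 v) = v" "\<And>v. J3 (J3 v) = v"
      "\<And>v. J1 (J2 v) = J3 v" "\<And>v. J2 (J1 v) = - J3 v"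
    and x: "h x x \<noteq> 0"
  shows "g v w = g x x / h x x * h v w"
proof -
  define F where
    "F s = (s$1) *\<^sub>R x + (s$2) *\<^sub>R J1 x + (s$3) *\<^sub>R J2 x + (s$4) *\<^sub>R J3 x" for s :: "real^4"
  define Q where "Q s t = s$1 * t$1 + s$2 * t$2 - s$3 * t$3 - s$4 * t$4" for s t :: "real^4"
  have hF: "h (F s) (F t) = h x x * Q s t" for s t
    unfolding F_def Q_def by (rule compatible_form_in_frame[where ?J1.0=J1 and ?J2.0=J2 and ?J3.0=J3 and b=h,
          OF h r])
  have gF: "g (F s) (F t) = g x x * Q s t" for s t
    unfolding F_def Q_def by (rule compatible_form_in_frame[where ?J1.0=J1 and ?J2.0=J2 and ?J3.0=J3 and b=g,
          OF g r])
  have lin: "linear F"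
    by (rule linearI) (simp_all add: F_def algebra_simps)
  have "s = 0" if "F s = 0" for s
  proof -
    have "Q s t = 0" for t
      using hF[of s t] that x by (simp add: bilinear_lzero[OF h(1)])
    \<comment> \<open>Pairing with the axis vectors returns each coordinate of \<open>s\<close> up
      to sign, so \<open>Q\<close> is non-degenerate.\<close>
    from this[of "axis 1 1"] this[of "axis 2 1"] this[of "axis 3 1"] this[of "axis 4 1"]
    show ?thesis
      by (simp add: Q_def axis_def vec_eq_iff forall_4)
  qed
  \<comment> \<open>Dimension four enters here: an injective linear map from \<open>real^4\<close>
    to itself is onto, so the frame spans.\<close>
  then have "surj F"
    using lin by (simp add: linear_injective_imp_surjective linear_injective_0)
  then obtain s t where "v = F s" "w = F t"
    by (metis surjD)
  then show ?thesis
    using x by (simp add: hF gF)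
qed

text \<open>Polarization: if \<open>v\<close>, \<open>w\<close> and \<open>v + w\<close> were all
  null, \<open>2 * b v w\<close> would vanish.\<close>

lemma nonzero_form_has_nonnull_vector:
  assumes b: "bilinear b" and sym: "\<And>v w. b v w = b w v" and "b v w \<noteq> (0::real)"
  obtains x where "b x x \<noteq> 0"
proof -
  have "b (v + w) (v + w) = b v v + 2 * b v w + b w w"
    using sym[of w v] by (simp add: bilinear_ladd[OF b] bilinear_radd[OF b])
  then show ?thesis
    using assms(3) that by (metis add.left_neutral add.right_neutral mult_eq_0_iff zero_neq_numeral)
qed

lemma bilinear_eq_0_on_Basis:
  fixes b :: "'a::euclidean_space \<Rightarrow> 'a \<Rightarrow> real"
  assumes b: "bilinear b" and "\<And>i j. i \<in> Basis \<Longrightarrow> j \<in> Basis \<Longrightarrow> b i j = 0"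
  shows "b v w = 0"
proof -
  have "b (\<Sum>i\<in>Basis. (v \<bullet> i) *\<^sub>R i) (\<Sum>i\<in>Basis. (w \<bullet> i) *\<^sub>R i) = 0"
    by (subst bilinear_sum[OF b])
      (auto intro!: sum.neutral simp: assms(2) bilinear_lmul[OF b] bilinear_rmul[OF b])
  then show ?thesis by (simp add: euclidean_representation)
qed

section \<open>Tangent vectors in a chart\<close>

locale atlas_chart =
  fixes A :: "('m::{t2_space, second_countable_topology}, 'e::euclidean_space) chart set"
    and c :: "('m, 'e) chart" and p :: 'm
  assumes atlas: "smooth_atlas A" and c_at: "c \<in> charts_at A p"
begin

text \<open>The inverse of taking the \<open>c\<close>-component. It identifies \<open>'e\<close>
  linearly with the tangent space at \<open>p\<close>, so that pointwise claims become linear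
  algebra on \<open>'e\<close>.\<close>

abbreviation "E v \<equiv> coord_vector A c v p"

lemma is_chart: "d \<in> charts_at A q \<Longrightarrow> is_chart d"
  using atlas by (auto simp: smooth_atlas_def charts_at_def)

lemma chart_inv_map: "d \<in> charts_at A q \<Longrightarrow> r \<in> chart_dom d \<Longrightarrow> chart_inv d (chart_map d r) = r"
  using is_chart[of d q] by (simp add: is_chart_def homeomorphism_def)

lemma open_overlap:
  assumes "d \<in> charts_at A q" and "e \<in> charts_at A q"
  shows "open (chart_map d ` (chart_dom d \<inter> chart_dom e))"
proof -
  note d = is_chart[OF assms(1), unfolded is_chart_def]
  have "openin (top_of_set (chart_dom d)) (chart_dom d \<inter> chart_dom e)"
    using is_chart[OF assms(2)] by (auto simp: is_chart_def openin_open_Int)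
  then show ?thesis
    using d homeomorphism_imp_open_map openin_open_trans by blast
qed

lemma transition_has_derivative:
  assumes d: "d \<in> charts_at A q" and e: "e \<in> charts_at A q"
  shows "(transition d e has_derivative frechet_derivative (transition d e) (at (chart_map d q)))
          (at (chart_map d q))"
proof -
  have "smooth_on (chart_map d ` (chart_dom d \<inter> chart_dom e)) (transition d e)"
    using atlas d e by (auto simp: smooth_atlas_def charts_at_def)
  then have "Ck_on (chart_map d ` (chart_dom d \<inter> chart_dom e)) (Suc 0) (transition d e)"
    unfolding smooth_on_def by blast
  then show ?thesis
    by (rule Ck_on_SucD(1)) (use d e in \<open>auto simp: charts_at_def\<close>)
qed

text \<open>The chain rule. The composite is compared with \<open>transition c e\<close> only on the
  open image of the overlap, the region where \<open>chart_inv\<close> undoes both chart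
  maps.\<close>

lemma transition_chain:
  assumes d: "d \<in> charts_at A p" and e: "e \<in> charts_at A p"
  shows "frechet_derivative (transition c e) (at (chart_map c p)) v =
    frechet_derivative (transition d e) (at (chart_map d p))
      (frechet_derivative (transition c d) (at (chart_map c p)) v)"
proof -
  let ?x = "chart_map c p"
  let ?D = "frechet_derivative (transition d e) (at (chart_map d p)) \<circ>
    frechet_derivative (transition c d) (at ?x)"
  have p: "p \<in> chart_dom c" "p \<in> chart_dom d"
    using c_at d by (auto simp: charts_at_def)
  have "transition c d ?x = chart_map d p"
    using chart_inv_map[OF c_at p(1)] by (simp add: transition_def)
  then have "(transition d e \<circ> transition c d has_derivative ?D) (at ?x)"
    by (intro diff_chain_at transition_has_derivative[OF c_at d])
      (simp add: transition_has_derivative[OF d e])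
  then have "(transition c e has_derivative ?D) (at ?x)"
  proof (rule has_derivative_transform_within_open[OF _ open_overlap[OF c_at d]])
    show "(transition d e \<circ> transition c d) y = transition c e y"
      if "y \<in> chart_map c ` (chart_dom c \<inter> chart_dom d)" for y
      using that by (auto simp: transition_def chart_inv_map[OF c_at] chart_inv_map[OF d])
  qed (use p in auto)
  then show ?thesis
    by (metis frechet_derivative_at comp_apply)
qed

text \<open>The identity \<open>transition_chain\<close> is exactly the required relation between
  the components in two charts.\<close>

lemma E_in_tangent_space: "E v \<in> tangent_space A p"
  by (simp add: tangent_space_def coord_vector_def transition_chain[symmetric])

text \<open>Near the point \<open>transition c c\<close> is the identity, hence so is its
  derivative.\<close>

lemma E_at_chart: "E v c = v"
proof -
  have p: "p \<in> chart_dom c"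
    using c_at by (auto simp: charts_at_def)
  have "(transition c c has_derivative (\<lambda>v. v)) (at (chart_map c p))"
  proof (rule has_derivative_transform_within_open[OF has_derivative_ident open_overlap[OF c_at c_at]])
    show "y = transition c c y" if "y \<in> chart_map c ` (chart_dom c \<inter> chart_dom c)" for y
      using that by (auto simp: transition_def chart_inv_map[OF c_at])
  qed (use p in auto)
  then have "frechet_derivative (transition c c) (at (chart_map c p)) = (\<lambda>v. v)"
    by (metis frechet_derivative_at)
  then show ?thesis
    by (simp add: coord_vector_def c_at)
qed

lemma E_of_component:
  assumes "X \<in> tangent_space A p"
  shows "E (X c) = X"
proof
  fix d
  have "d \<in> charts_at A p \<Longrightarrow>
      X d = frechet_derivative (transition c d) (at (chart_map c p)) (X c)"
    and "d \<notin> charts_at A p \<Longrightarrow> X d = 0"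
    using assms c_at unfolding tangent_space_def by blast+
  then show "E (X c) d = X d"
    unfolding coord_vector_def by metis
qed

lemma E_lincomb: "E (a *\<^sub>R v + b *\<^sub>R w) = lincomb a (E v) b (E w)"
proof
  fix d
  show "E (a *\<^sub>R v + b *\<^sub>R w) d = lincomb a (E v) b (E w) d"
  proof (cases "d \<in> charts_at A p")
    case True
    then have "linear (frechet_derivative (transition c d) (at (chart_map c p)))"
      using transition_has_derivative[OF c_at] has_derivative_linear by blast
    then show ?thesis
      using True by (simp add: coord_vector_def lincomb_def linear_add linear_scale)
  qed (simp add: coord_vector_def lincomb_def)
qed

section \<open>Metrics and endomorphisms in coordinates\<close>

lemma metric_bilinear:
  assumes "pseudo_riemannian_metric A g"
  shows "bilinear (\<lambda>v w. g p (E v) (E w))" and "g p (E v) (E w) = g p (E w) (E v)"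
proof -
  have lin: "g p (E (a *\<^sub>R v + b *\<^sub>R w)) (E u) = a * g p (E v) (E u) + b * g p (E w) (E u)" for a b v w u
    using assms unfolding E_lincomb
    by (simp add: pseudo_riemannian_metric_def smooth_symmetric_2tensor_def E_in_tangent_space)
  show sym: "g p (E v) (E w) = g p (E w) (E v)" for v w
    using assms
    by (simp add: pseudo_riemannian_metric_def smooth_symmetric_2tensor_def E_in_tangent_space)
  have "linear (\<lambda>v. g p (E v) (E u))" for u
    \<comment> \<open>Coefficients 1 and 1 give additivity; a zero second coefficient gives
      homogeneity. Symmetry then carries linearity over to the other argument.\<close>
    by (rule linearI) (use lin[of 1 _ 1 _ u] lin[of _ _ 0 0 u] in auto)
  then show "bilinear (\<lambda>v w. g p (E v) (E w))"
    unfolding bilinear_def by (subst (1) sym) blast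
qed

text \<open>A nonzero \<open>u\<close> in \<open>'e\<close> gives a nonzero tangent vector
  \<open>E u\<close>, since its \<open>c\<close>-component is \<open>u\<close>; non-degeneracy then
  supplies a partner.\<close>

lemma metric_nonzero:
  assumes "pseudo_riemannian_metric A g"
  obtains v w where "g p (E v) (E w) \<noteq> 0"
proof -
  obtain u :: 'e where u: "u \<noteq> 0"
    using nonzero_Basis SOME_Basis by blast
  then have "E u \<noteq> (\<lambda>c. 0)"
    using E_at_chart[of u] by metis
  then obtain Y where "Y \<in> tangent_space A p" "g p (E u) Y \<noteq> 0"
    using assms E_in_tangent_space[of u] unfolding pseudo_riemannian_metric_def by blast
  then show ?thesis
    using that E_of_component by metis
qed

lemma metric_nonnull:
  assumes "pseudo_riemannian_metric A g"
  obtains x where "g p (E x) (E x) \<noteq> 0"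
proof -
  obtain v w where "g p (E v) (E w) \<noteq> 0"
    by (rule metric_nonzero[OF assms])
  from metric_bilinear[OF assms] this that show ?thesis
    by (rule nonzero_form_has_nonnull_vector[of "\<lambda>v w. g p (E v) (E w)"])
qed

lemma metric_nonzero_Basis:
  assumes "pseudo_riemannian_metric A g"
  obtains i j where "i \<in> Basis" "j \<in> Basis" "g p (E i) (E j) \<noteq> 0"
proof -
  obtain v w where "g p (E v) (E w) \<noteq> 0"
    by (rule metric_nonzero[OF assms])
  then show ?thesis
    using that bilinear_eq_0_on_Basis[of "\<lambda>v w. g p (E v) (E w)" v w]
      metric_bilinear(1)[OF assms] by blast
qed

text \<open>Makes \<open>\<lambda>v. J p (E v) c\<close> usable as the coordinate form of
  \<open>J\<close>: applying \<open>E\<close> to its values recovers \<open>J\<close>, so relations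
  between compositions descend to \<open>'e\<close>.\<close>

lemma endo_component:
  assumes "smooth_endomorphism A J"
  shows "E (J p (E v) c) = J p (E v)"
proof (rule E_of_component)
  show "J p (E v) \<in> tangent_space A p"
    using assms E_in_tangent_space[of v] unfolding smooth_endomorphism_def by blast
qed

end

section \<open>Proportionality of compatible metrics and the conformal factor\<close>

lemma compatible_metrics_proportional_at:
  fixes A :: "('m::{t2_space, second_countable_topology}, real^4) chart set"
  assumes "atlas_chart A c p"
    and J: "almost_para_hypercomplex A J1 J2 J3"
    and g: "pseudo_riemannian_metric A g" "compatible A J1 J2 J3 g"
    and h: "pseudo_riemannian_metric A h" "compatible A J1 J2 J3 h"
  shows "\<exists>a. a \<noteq> 0 \<and> (\<forall>X\<in>tangent_space A p. \<forall>Y\<in>tangent_space A p. g p X Y = a * h p X Y)"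
proof -
  interpret atlas_chart A c p by fact
  have smooth: "smooth_endomorphism A J1" "smooth_endomorphism A J2" "smooth_endomorphism A J3"
    and rel: "\<And>X. X \<in> tangent_space A p \<Longrightarrow>
      J1 p (J1 p X) = - X \<and> J2 p (J2 p X) = X \<and> J3 p (J3 p X) = X \<and>
      J1 p (J2 p X) = J3 p X \<and> J2 p (J1 p X) = - J3 p X"
    using J unfolding almost_para_hypercomplex_def by blast+
  note comp = smooth[THEN endo_component]
  note relE = rel[OF E_in_tangent_space]
  obtain x where x: "h p (E x) (E x) \<noteq> 0"
    by (rule metric_nonnull[OF h(1)])
  have compat: "b p (J1 p (E v)) (J1 p (E w)) = b p (E v) (E w)"
    "b p (J2 p (E v)) (J2 p (E w)) = - b p (E v) (E w)"
    "b p (J3 p (E v)) (J3 p (E w)) = - b p (E v) (E w)"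
    if "compatible A J1 J2 J3 b" for b v w
    using that E_in_tangent_space unfolding compatible_def by (metis minus_minus)+
  define a where "a = g p (E x) (E x) / h p (E x) (E x)"
  have "g p (E v) (E w) = a * h p (E v) (E w)" for v w
    unfolding a_def
    by (rule compatible_forms_proportional[where g="\<lambda>v w. g p (E v) (E w)" and
          h="\<lambda>v w. h p (E v) (E w)" and ?J1.0="\<lambda>v. J1 p (E v) c" and
          ?J2.0="\<lambda>v. J2 p (E v) c" and ?J3.0="\<lambda>v. J3 p (E v) c"])
      (simp_all add: metric_bilinear(1)[OF g(1)] metric_bilinear(1)[OF h(1)] x
        comp compat[OF g(2)] compat[OF h(2)] relE E_at_chart,
        (rule metric_bilinear(2)[OF g(1)] metric_bilinear(2)[OF h(1)])+)
  then have eq: "\<forall>X\<in>tangent_space A p. \<forall>Y\<in>tangent_space A p. g p X Y = a * h p X Y"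
    by (metis E_of_component)
  \<comment> \<open>With \<open>a = 0\<close> the metric \<open>g\<close> would vanish on all pairs
    at \<open>p\<close>.\<close>
  obtain v w where "g p (E v) (E w) \<noteq> 0"
    by (rule metric_nonzero[OF g(1)])
  then have "a \<noteq> 0"
    using eq E_in_tangent_space by auto
  with eq show ?thesis by blast
qed

text \<open>The non-null vector found at each point need not vary smoothly, so \<open>f\<close> is
  recovered from all components at once.\<close>

lemma proportionality_factor_smooth:
  fixes A :: "('m::{t2_space, second_countable_topology}, 'e::euclidean_space) chart set"
  assumes A: "smooth_atlas A"
    and g: "pseudo_riemannian_metric A g" and h: "pseudo_riemannian_metric A h"
    and eq: "\<And>p X Y. X \<in> tangent_space A p \<Longrightarrow> Y \<in> tangent_space A p \<Longrightarrow> g p X Y = f p * h p X Y"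
  shows "smooth_fun A f"
  unfolding smooth_fun_def
proof
  fix c assume c: "c \<in> A"
  then have "is_chart c"
    using A by (auto simp: smooth_atlas_def)
  then have op: "open (chart_img c)"
    and inv: "\<And>x. x \<in> chart_img c \<Longrightarrow> chart_inv c x \<in> chart_dom c"
    by (auto simp: is_chart_def homeomorphism_def)
  \<comment> \<open>Component matrix of \<open>b\<close> in the chart, indexed by pairs so that
    double sums become single sums over \<open>I\<close>.\<close>
  define m where "m b x ij =
    b (chart_inv c x) (coord_vector A c (fst ij) (chart_inv c x))
      (coord_vector A c (snd ij) (chart_inv c x))"
    for b :: "('m, 'e) bilinear_field" and x ij
  define I :: "('e \<times> 'e) set" where "I = Basis \<times> Basis"
  have I: "finite I"
    by (simp add: I_def)
  have smooth: "Ck_on (chart_img c) k (\<lambda>x. m b x ij)"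
    if "pseudo_riemannian_metric A b" "ij \<in> I" for b ij k
    using that c unfolding m_def I_def pseudo_riemannian_metric_def smooth_symmetric_2tensor_def
      smooth_on_def by auto
  \<comment> \<open>Although \<open>h\<close> may be indefinite, the sum of the squares of its
    components is positive, because non-degeneracy makes one of them nonzero. Dividing by it solves
    the proportionality for \<open>f\<close>.\<close>
  have pt: "(\<Sum>ij\<in>I. m h x ij * m h x ij) \<noteq> 0"
    "(\<Sum>ij\<in>I. m g x ij * m h x ij) * inverse (\<Sum>ij\<in>I. m h x ij * m h x ij) = f (chart_inv c x)"
    if "x \<in> chart_img c" for x
  proof -
    interpret atlas_chart A c "chart_inv c x"
      by unfold_locales (use A c inv[OF that] in \<open>auto simp: charts_at_def\<close>)
    obtain i j where "i \<in> Basis" "j \<in> Basis" "m h x (i, j) \<noteq> 0"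
      using metric_nonzero_Basis[OF h] unfolding m_def by (metis fst_conv snd_conv)
    then have "(\<Sum>ij\<in>I. m h x ij * m h x ij) > 0"
      by (intro sum_pos2[OF I, of "(i, j)"]) (auto simp: I_def zero_less_mult_iff)
    then show ne: "(\<Sum>ij\<in>I. m h x ij * m h x ij) \<noteq> 0"
      by simp
    have "m g x ij = f (chart_inv c x) * m h x ij" for ij
      unfolding m_def by (intro eq E_in_tangent_space)
    then have "(\<Sum>ij\<in>I. m g x ij * m h x ij) = f (chart_inv c x) * (\<Sum>ij\<in>I. m h x ij * m h x ij)"
      by (simp add: sum_distrib_left mult.assoc)
    then show "(\<Sum>ij\<in>I. m g x ij * m h x ij) * inverse (\<Sum>ij\<in>I. m h x ij * m h x ij)
        = f (chart_inv c x)"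
      using ne by simp
  qed
  have sums: "Ck_on (chart_img c) k (\<lambda>x. \<Sum>ij\<in>I. m b x ij * m h x ij)"
    if "pseudo_riemannian_metric A b" for b k
    by (intro Ck_on_sum[OF op] Ck_on_mult[OF op] smooth that h)
  have "Ck_on (chart_img c) k
      (\<lambda>x. (\<Sum>ij\<in>I. m g x ij * m h x ij) * inverse (\<Sum>ij\<in>I. m h x ij * m h x ij))" for k
    by (rule Ck_on_mult[OF op sums[OF g] Ck_on_inverse[OF op pt(1) sums[OF h]]])
  then have "Ck_on (chart_img c) k (f \<circ> chart_inv c)" for k
    by (rule Ck_on_cong[OF op, rotated]) (simp add: pt(2))
  then show "smooth_on (chart_img c) (f \<circ> chart_inv c)"
    unfolding smooth_on_def by blast
qed

theorem proposition13:
  fixes A :: "('m::{t2_space, second_countable_topology}, real^4) chart set"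
    and J1 J2 J3 :: "('m, real^4) endo_field"
    and g h :: "('m, real^4) bilinear_field"
  assumes "smooth_atlas A"
    and "almost_para_hypercomplex A J1 J2 J3"
    and "pseudo_riemannian_metric A g" and "compatible A J1 J2 J3 g"
    and "pseudo_riemannian_metric A h" and "compatible A J1 J2 J3 h"
  shows "\<exists>!f :: 'm \<Rightarrow> real. smooth_fun A f \<and> (\<forall>p. f p \<noteq> 0) \<and>
           (\<forall>p. \<forall>X\<in>tangent_space A p. \<forall>Y\<in>tangent_space A p. g p X Y = f p * h p X Y)"
proof -
  have chart: "\<exists>c. atlas_chart A c p" for p
  proof -
    have "p \<in> (\<Union>c\<in>A. chart_dom c)"
      using assms(1) by (simp add: smooth_atlas_def)
    then show ?thesis
      using assms(1) by (auto simp: atlas_chart_def charts_at_def)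
  qed
  have "\<forall>p. \<exists>a. a \<noteq> 0 \<and> (\<forall>X\<in>tangent_space A p. \<forall>Y\<in>tangent_space A p. g p X Y = a * h p X Y)"
    using chart compatible_metrics_proportional_at[OF _ assms(2-6)] by blast
  \<comment> \<open>This \<open>f\<close> is a pointwise choice; its smoothness follows afterwards
    from the equation alone.\<close>
  then obtain f where f: "\<And>p. f p \<noteq> 0"
    "\<And>p X Y. X \<in> tangent_space A p \<Longrightarrow> Y \<in> tangent_space A p \<Longrightarrow> g p X Y = f p * h p X Y"
    by metis
  show ?thesis
  proof (rule ex1I[of _ f])
    show "smooth_fun A f \<and> (\<forall>p. f p \<noteq> 0) \<and>
      (\<forall>p. \<forall>X\<in>tangent_space A p. \<forall>Y\<in>tangent_space A p. g p X Y = f p * h p X Y)"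
      using proportionality_factor_smooth[OF assms(1,3,5) f(2)] f by blast
  next
    fix f'
    assume f': "smooth_fun A f' \<and> (\<forall>p. f' p \<noteq> 0) \<and>
      (\<forall>p. \<forall>X\<in>tangent_space A p. \<forall>Y\<in>tangent_space A p. g p X Y = f' p * h p X Y)"
    show "f' = f"
    proof
      fix p
      obtain c where "atlas_chart A c p"
        using chart by blast
      then interpret atlas_chart A c p .
      \<comment> \<open>On a pair where \<open>h\<close> is nonzero, \<open>f' p\<close> and
        \<open>f p\<close> give the same product and \<open>h\<close> cancels.\<close>
      obtain v w where "h p (E v) (E w) \<noteq> 0"
        by (rule metric_nonzero[OF assms(5)])
      then show "f' p = f p"
        using f' f(2) E_in_tangent_space by (metis mult_cancel_right)
    qed
  qed
qed

end
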